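(* If $E_1$ and $E_2$ are $\leq$-incomparable dark ceers, then (the degrees of) $E_1$ and $E_2$ have no least upper bound in the poset of degrees of ceers.
   Context: A ceer is a computably enumerable equivalence relation on $\omega$. For equivalence relations $E,R$ on $\omega$, $E\leq R$ means there is a computable $f$ with $x\mathrel{E}y\iff f(x)\mathrel{R}f(y)$ for all $x,y$; the degrees of ceers are the classes of mutual reducibility, partially ordered by $\leq$. $\mathrm{Id}$ is equality on $\omega$. A ceer $R$ is dark if it has infinitely many classes and $\mathrm{Id}\not\leq R$. *)

theory Defs
  imports "HOL-Library.Nat_Bijection" "HOL-Algebra.Order"
begin

section \<open>Computable functions\<close>

text \<open>
  Kleene's partial recursive functions: \<open>evaluates p xs y\<close> says that the program \<open>p\<close> halts on
  the inputs \<open>xs\<close> with output \<open>y\<close>. Primitive recursion and minimisation act on the first input.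
\<close>

datatype program =
    Zero
  | Succ
  | Proj nat
  | Comp program "program list"
  | PrimRec program program
  | Mu program

inductive evaluates :: "program \<Rightarrow> nat list \<Rightarrow> nat \<Rightarrow> bool" where
  Zero: "evaluates Zero xs 0"
| Succ: "evaluates Succ [x] (Suc x)"
| Proj: "i < length xs \<Longrightarrow> evaluates (Proj i) xs (xs ! i)"
| Comp: "list_all2 (\<lambda>q y. evaluates q xs y) qs ys \<Longrightarrow> evaluates p ys z
    \<Longrightarrow> evaluates (Comp p qs) xs z"
| PrimRec_0: "evaluates p xs y \<Longrightarrow> evaluates (PrimRec p q) (0 # xs) y"
| PrimRec_Suc: "evaluates (PrimRec p q) (n # xs) y \<Longrightarrow> evaluates q (n # y # xs) z
    \<Longrightarrow> evaluates (PrimRec p q) (Suc n # xs) z"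
| Mu: "evaluates p (n # xs) 0 \<Longrightarrow> (\<And>i. i < n \<Longrightarrow> \<exists>y. evaluates p (i # xs) (Suc y))
    \<Longrightarrow> evaluates (Mu p) xs n"

inductive_cases evaluates_ZeroE: "evaluates Zero xs z"
inductive_cases evaluates_SuccE: "evaluates Succ xs z"
inductive_cases evaluates_ProjE: "evaluates (Proj i) xs z"
inductive_cases evaluates_CompE: "evaluates (Comp p qs) xs z"
inductive_cases evaluates_PrimRec_0E: "evaluates (PrimRec p q) (0 # xs) z"
inductive_cases evaluates_PrimRec_SucE: "evaluates (PrimRec p q) (Suc n # xs) z"
inductive_cases evaluates_MuE: "evaluates (Mu p) xs z"

lemma evaluates_unique: "evaluates p xs y \<Longrightarrow> evaluates p xs z \<Longrightarrow> y = z"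
proof (induction arbitrary: z rule: evaluates.induct)
  case (Zero xs)
  then show ?case by (rule evaluates_ZeroE) simp
next
  case (Succ x)
  then show ?case by (rule evaluates_SuccE) simp
next
  case (Proj i xs)
  from Proj.prems show ?case by (rule evaluates_ProjE) simp
next
  case (Comp xs qs ys p u)
  from Comp.prems obtain ys' where ys': "list_all2 (\<lambda>q y. evaluates q xs y) qs ys'"
    and z: "evaluates p ys' z"
    by (rule evaluates_CompE)
  have "ys = ys'"
    using Comp.IH(1) ys' by (auto simp: list_all2_conv_all_nth intro!: nth_equalityI)
  with Comp.IH(2) z show ?case by blast
next
  case (PrimRec_0 p xs y q)
  from PrimRec_0.prems show ?case by (rule evaluates_PrimRec_0E) (rule PrimRec_0.IH)
next
  case (PrimRec_Suc p q n xs y u)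
  from PrimRec_Suc.prems show ?case
  proof (rule evaluates_PrimRec_SucE)
    fix y' assume "evaluates (PrimRec p q) (n # xs) y'" "evaluates q (n # y' # xs) z"
    with PrimRec_Suc.IH show ?thesis by blast
  qed
next
  case (Mu p n xs)
  from Mu.prems show ?case
  proof (rule evaluates_MuE)
    assume z: "evaluates p (z # xs) 0"
      and less: "\<And>i. i < z \<Longrightarrow> \<exists>y. evaluates p (i # xs) (Suc y)"
    show ?thesis
    proof (rule linorder_cases[of n z])
      assume "n < z"
      with less obtain y where "evaluates p (n # xs) (Suc y)" by blast
      with Mu.IH(1) show ?thesis by blast
    next
      assume "z < n"
      with Mu.IH(2) obtain y where "\<forall>w. evaluates p (z # xs) w \<longrightarrow> Suc y = w" by blast
      with z show ?thesis by blast
    qed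
  qed
qed

definition computable :: "(nat \<Rightarrow> nat) \<Rightarrow> bool" where
  "computable f \<longleftrightarrow> (\<exists>p. \<forall>x. evaluates p [x] (f x))"

lemma computable_id: "computable (\<lambda>x. x)"
  unfolding computable_def using evaluates.Proj[of 0 "[x]" for x] by (intro exI[of _ "Proj 0"]) auto

lemma computable_comp:
  assumes "computable f" "computable g"
  shows "computable (\<lambda>x. f (g x))"
proof -
  obtain p q where "\<And>x. evaluates p [x] (f x)" "\<And>x. evaluates q [x] (g x)"
    using assms unfolding computable_def by blast
  then have "evaluates (Comp p [q]) [x] (f (g x))" for x
    by (intro evaluates.Comp[where ys = "[g x]"]) auto
  then show ?thesis unfolding computable_def by blast
qed


section \<open>Ceers\<close>

definition ce_set :: "nat set \<Rightarrow> bool" where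
  "ce_set A \<longleftrightarrow> A = {} \<or> (\<exists>f. computable f \<and> A = range f)"

text \<open>Pairs are coded by the Cantor pairing function.\<close>

definition ceer :: "nat rel \<Rightarrow> bool" where
  "ceer R \<longleftrightarrow> equiv UNIV R \<and> ce_set (prod_encode ` R)"

definition reducible :: "nat rel \<Rightarrow> nat rel \<Rightarrow> bool" (infix \<open>\<preceq>\<close> 50) where
  "E \<preceq> R \<longleftrightarrow> (\<exists>f. computable f \<and> (\<forall>x y. (x, y) \<in> E \<longleftrightarrow> (f x, f y) \<in> R))"

lemma reducible_refl: "E \<preceq> E"
  unfolding reducible_def using computable_id by blast

lemma reducible_trans: "E \<preceq> R \<Longrightarrow> R \<preceq> S \<Longrightarrow> E \<preceq> S"
  unfolding reducible_def by (metis computable_comp)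

definition dark :: "nat rel \<Rightarrow> bool" where
  "dark R \<longleftrightarrow> ceer R \<and> infinite (UNIV // R) \<and> \<not> Id \<preceq> R"


section \<open>The poset of degrees of ceers\<close>

definition ceer_equiv :: "nat rel rel" where
  "ceer_equiv = {(E, R). ceer E \<and> ceer R \<and> E \<preceq> R \<and> R \<preceq> E}"

definition degree :: "nat rel \<Rightarrow> nat rel set" where
  "degree E = ceer_equiv `` {E}"

definition ceer_degrees :: "nat rel set gorder" where
  "ceer_degrees =
    \<lparr>carrier = {E. ceer E} // ceer_equiv, eq = (=), le = (\<lambda>D D'. \<exists>E\<in>D. \<exists>R\<in>D'. E \<preceq> R)\<rparr>"

lemma equiv_ceer_equiv: "equiv {E. ceer E} ceer_equiv"
  unfolding ceer_equiv_def
  by (rule equivI) (auto simp: refl_on_def sym_def trans_def intro: reducible_refl reducible_trans)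

lemma degree_in_carrier: "ceer E \<Longrightarrow> degree E \<in> carrier ceer_degrees"
  by (auto simp: ceer_degrees_def degree_def intro: quotientI)

lemma carrier_ceer_degrees: "carrier ceer_degrees = {degree E |E. ceer E}"
  by (auto simp: ceer_degrees_def degree_def quotient_def)

lemma degree_le_iff:
  assumes "ceer E" "ceer R"
  shows "degree E \<sqsubseteq>\<^bsub>ceer_degrees\<^esub> degree R \<longleftrightarrow> E \<preceq> R"
  using assms reducible_refl reducible_trans
  unfolding ceer_degrees_def degree_def ceer_equiv_def by (simp; blast)

lemma degree_eq_iff:
  assumes "ceer E" "ceer R"
  shows "degree E = degree R \<longleftrightarrow> E \<preceq> R \<and> R \<preceq> E"
  using eq_equiv_class_iff[OF equiv_ceer_equiv, of E R] assms
  by (simp add: degree_def ceer_equiv_def)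

lemma partial_order_ceer_degrees: "partial_order ceer_degrees"
proof -
  have [simp]: "eq ceer_degrees = (=)" by (simp add: ceer_degrees_def)
  show ?thesis
    by unfold_locales
      (auto simp: carrier_ceer_degrees degree_le_iff degree_eq_iff
        intro: reducible_refl reducible_trans del: equalityI subsetI)
qed

end

theory Submission
  imports Defs
begin

text \<open>
  The key point is that a dark ceer \<open>X\<close> never reduces to a proper quotient \<open>X/(a,b)\<close> that merges
  two classes. A reduction \<open>f\<close> of \<open>X\<close> to \<open>X/(a,b)\<close> reflects \<open>X\<close>, so by darkness every orbit of
  \<open>f\<close> returns to the class where it starts; going backwards from \<open>a\<close> and from \<open>b\<close>, which share
  their preimage class, contradicts the minimality of the return times.

  A least upper bound \<open>X\<close> of \<open>E1\<close> and \<open>E2\<close> lies below \<open>E1 \<oplus> E2\<close> and so does not bound \<open>Id\<close>.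
  By incomparability neither \<open>E1\<close> nor \<open>E2\<close> meets all classes of \<open>X\<close>; merging a class missed by
  \<open>E1\<close> with a class missed by \<open>E2\<close> gives an upper bound to which \<open>X\<close> does not reduce.
\<close>

section \<open>Computable functions\<close>

text \<open>Programs act on input lists, so a binary function is given by a program with two inputs.
  The pairing function is itself shown computable through this notion.\<close>

definition computable2 :: "(nat \<Rightarrow> nat \<Rightarrow> nat) \<Rightarrow> bool" where
  "computable2 h \<longleftrightarrow> (\<exists>p. \<forall>x y. evaluates p [x, y] (h x y))"

lemma evaluates_nth: "i < length xs \<Longrightarrow> xs ! i = y \<Longrightarrow> evaluates (Proj i) xs y"
  using evaluates.Proj by blast

lemma evaluates_Comp1: "evaluates q xs y \<Longrightarrow> evaluates p [y] z \<Longrightarrow> evaluates (Comp p [q]) xs z"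
  by (rule evaluates.Comp[where ys = "[y]"]) auto

lemma evaluates_Comp2:
  "evaluates q1 xs y1 \<Longrightarrow> evaluates q2 xs y2 \<Longrightarrow> evaluates p [y1, y2] z
    \<Longrightarrow> evaluates (Comp p [q1, q2]) xs z"
  by (rule evaluates.Comp[where ys = "[y1, y2]"]) auto

lemma evaluates_Comp3:
  "evaluates q1 xs y1 \<Longrightarrow> evaluates q2 xs y2 \<Longrightarrow> evaluates q3 xs y3 \<Longrightarrow> evaluates p [y1, y2, y3] z
    \<Longrightarrow> evaluates (Comp p [q1, q2, q3]) xs z"
  by (rule evaluates.Comp[where ys = "[y1, y2, y3]"]) auto

text \<open>One program serves input lists of every length, including the empty list on which
  \<open>computable_rec_nat\<close> runs its base case.\<close>

lemma evaluates_const: "\<exists>p. \<forall>xs. evaluates p xs c"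
proof (induction c)
  case 0
  then show ?case using evaluates.Zero by blast
next
  case (Suc c)
  then show ?case using evaluates_Comp1 evaluates.Succ by blast
qed

lemma computable_const: "computable (\<lambda>x. c)"
  unfolding computable_def using evaluates_const by blast

lemma computable_Suc: "computable Suc"
  unfolding computable_def using evaluates.Succ by blast

lemma computable2_app:
  assumes "computable2 h" "computable f" "computable g"
  shows "computable (\<lambda>x. h (f x) (g x))"
  using assms unfolding computable_def computable2_def by (meson evaluates_Comp2)

text \<open>Recursion and minimisation act on the first input, so the arguments often have to be
  exchanged to reach the form needed there.\<close>

lemma computable2_app_swap:
  assumes "computable2 h" "computable f" "computable g"
  shows "computable2 (\<lambda>x y. h (f y) (g x))"
proof -
  obtain p q r where "\<And>x y. evaluates p [x, y] (h x y)" "\<And>x. evaluates q [x] (f x)"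
    "\<And>x. evaluates r [x] (g x)"
    using assms unfolding computable_def computable2_def by blast
  then have "evaluates (Comp p [Comp q [Proj 1], Comp r [Proj 0]]) [x, y] (h (f y) (g x))" for x y
    by (intro evaluates_Comp2[where ?y1.0 = "f y" and ?y2.0 = "g x"]
        evaluates_Comp1[where y = y] evaluates_Comp1[where y = x] evaluates_nth) auto
  then show ?thesis unfolding computable2_def by blast
qed

lemma computable_comp2:
  assumes "computable f" "computable2 h"
  shows "computable2 (\<lambda>x y. f (h x y))"
  using assms unfolding computable_def computable2_def by (meson evaluates_Comp1)

lemma computable_rec_nat:
  assumes "computable2 h"
  shows "computable (rec_nat c h)"
proof -
  obtain p q where p: "\<And>x y. evaluates p [x, y] (h x y)" and q: "\<And>xs. evaluates q xs c"
    using assms evaluates_const unfolding computable2_def by blast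
  have "evaluates (PrimRec q p) [n] (rec_nat c h n)" for n
    by (induction n) (auto intro: evaluates.PrimRec_0 evaluates.PrimRec_Suc p q)
  then show ?thesis unfolding computable_def by blast
qed

lemma computable2_rec_nat:
  assumes "computable f"
  shows "computable2 (\<lambda>n x. rec_nat x (\<lambda>_. f) n)"
proof -
  obtain p where p: "\<And>x. evaluates p [x] (f x)"
    using assms unfolding computable_def by blast
  \<comment> \<open>The step program sees the counter, the previous value and \<open>x\<close>, in
    this order; \<open>Proj 1\<close> picks the previous value.\<close>
  have "evaluates (PrimRec (Proj 0) (Comp p [Proj 1])) [n, x] (rec_nat x (\<lambda>_. f) n)" for n x
    by (induction n)
      (auto intro!: evaluates.PrimRec_0 evaluates.PrimRec_Suc evaluates_nth
        evaluates_Comp1[OF _ p])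
  then show ?thesis unfolding computable2_def by blast
qed

lemma computable_funpow: "computable f \<Longrightarrow> computable (\<lambda>n. (f ^^ n) x)"
proof -
  assume "computable f"
  then have "computable (\<lambda>n. rec_nat x (\<lambda>_. f) n)"
    using computable2_app[OF computable2_rec_nat computable_id computable_const] by blast
  moreover have "rec_nat x (\<lambda>_. f) n = (f ^^ n) x" for n by (induction n) auto
  ultimately show ?thesis by simp
qed

lemma computable2_add: "computable2 (+)"
proof -
  have "rec_nat x (\<lambda>_. Suc) n = n + x" for n x by (induction n) auto
  then show ?thesis using computable2_rec_nat[OF computable_Suc] by simp
qed

lemma computable_pred: "computable (\<lambda>x. x - 1)"
proof -
  have "computable2 (\<lambda>x y. x)" unfolding computable2_def using evaluates_nth[of 0 "[_, _]"] by force
  then have "computable (rec_nat 0 (\<lambda>x y. x))" by (rule computable_rec_nat)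
  moreover have "rec_nat 0 (\<lambda>x y. x) = (\<lambda>n. n - 1)"
    proof
    show "rec_nat 0 (\<lambda>x y. x) n = n - 1" for n :: nat by (cases n) auto
  qed
  ultimately show ?thesis by simp
qed

lemma computable2_diff: "computable2 (-)"
proof -
  have "rec_nat x (\<lambda>_ y. y - 1) n = x - n" for n x by (induction n) auto
  then have "computable2 (\<lambda>n x. x - n)" using computable2_rec_nat[OF computable_pred] by simp
  then show ?thesis
    using computable2_app_swap[OF _ computable_id computable_id] by blast
qed

lemmas computable_add = computable2_app[OF computable2_add]
lemmas computable_diff = computable2_app[OF computable2_diff]

lemma computable_if:
  assumes "computable c" "computable f" "computable g"
  shows "computable (\<lambda>x. if c x = 0 then f x else g x)"
proof -
  obtain p q r where "\<And>x. evaluates p [x] (c x)" "\<And>x. evaluates q [x] (f x)"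
    "\<And>x. evaluates r [x] (g x)"
    using assms unfolding computable_def by blast
  \<comment> \<open>Primitive recursion serves as a case distinction: the base case sees
    \<open>[x, y]\<close> and returns \<open>x\<close>; the step sees the counter, the previous
    value, \<open>x\<close> and \<open>y\<close>, and returns entry 3, which is
    \<open>y\<close>.\<close>
  moreover have "evaluates (PrimRec (Proj 0) (Proj 3)) [n, x, y] (if n = 0 then x else y)" for n x y
    by (induction n) (auto intro!: evaluates.PrimRec_0 evaluates.PrimRec_Suc evaluates_nth)
  ultimately have "evaluates (Comp (PrimRec (Proj 0) (Proj 3)) [p, q, r]) [x]
      (if c x = 0 then f x else g x)" for x
    by (intro evaluates_Comp3[of p "[x]" "c x" q "f x" r "g x"])
  then show ?thesis unfolding computable_def by blast
qed

lemma computable_if_eq: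
  assumes "computable c" "computable d" "computable f" "computable g"
  shows "computable (\<lambda>x. if c x = d x then f x else g x)"
proof -
  have "(c x - d x) + (d x - c x) = 0 \<longleftrightarrow> c x = d x" for x by auto
  then show ?thesis
    using computable_if[of "\<lambda>x. (c x - d x) + (d x - c x)" f g] assms
    by (simp only: computable_add computable_diff)
qed

lemma computable_Least:
  assumes "computable2 h" and ex: "\<And>x. \<exists>n. h n x = 0"
  shows "computable (\<lambda>x. LEAST n. h n x = 0)"
proof -
  obtain p where p: "\<And>x y. evaluates p [x, y] (h x y)"
    using assms unfolding computable2_def by blast
  have "evaluates (Mu p) [x] (LEAST n. h n x = 0)" for x
  proof (rule evaluates.Mu)
    have "h (LEAST n. h n x = 0) x = 0" using ex by (rule LeastI_ex)
    then show "evaluates p [LEAST n. h n x = 0, x] 0" using p by metis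
    show "\<exists>y. evaluates p [i, x] (Suc y)" if "i < (LEAST n. h n x = 0)" for i
      using p not_less_Least[OF that] by (metis not0_implies_Suc)
  qed
  then show ?thesis unfolding computable_def by blast
qed

section \<open>Computability of Cantor pairing and its inverse\<close>

lemma computable_triangle: "computable triangle"
proof -
  have "computable2 (\<lambda>x y. y + Suc x)"
    by (rule computable2_app_swap[OF computable2_add computable_id computable_Suc])
  then have "computable (rec_nat 0 (\<lambda>x y. y + Suc x))" by (rule computable_rec_nat)
  moreover have "rec_nat 0 (\<lambda>x y. y + Suc x) = triangle"
  proof
    show "rec_nat 0 (\<lambda>x y. y + Suc x) n = triangle n" for n by (induction n) auto
  qed
  ultimately show ?thesis by (simp only:)
qed

lemma computable2_prod_encode: "computable2 (\<lambda>x y. prod_encode (x, y))"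
proof -
  obtain p q where p: "\<And>x. evaluates p [x] (triangle x)"
    and q: "\<And>x y. evaluates q [x, y] (x + y)"
    using computable_triangle computable2_add unfolding computable_def computable2_def by blast
  have "evaluates (Comp q [Comp p [q], Proj 0]) [x, y] (prod_encode (x, y))" for x y
    unfolding prod_encode_def
    by (auto intro!: evaluates_Comp2[OF _ _ q] evaluates_Comp1[OF _ p] evaluates_nth q)
  then show ?thesis unfolding computable2_def by blast
qed

lemmas computable_prod_encode = computable2_app[OF computable2_prod_encode]

text \<open>The code of \<open>(x, y)\<close> is \<open>triangle (x + y) + x\<close>, so the codes
  on one diagonal lie below the next triangular number. The truncated difference is zero once that
  number exceeds the code, so a search for the first zero finds the diagonal.\<close>

lemma prod_decode_diagonal:
  "(LEAST n. Suc (prod_encode (x, y)) - triangle (Suc n) = 0) = x + y"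
proof (rule Least_equality)
  show "Suc (prod_encode (x, y)) - triangle (Suc (x + y)) = 0"
    by (simp add: prod_encode_def)
  show "x + y \<le> n" if "Suc (prod_encode (x, y)) - triangle (Suc n) = 0" for n
  proof (rule ccontr)
    assume "\<not> x + y \<le> n"
    then have "triangle (Suc n) \<le> triangle (x + y)"
      unfolding triangle_def by (intro div_le_mono mult_le_mono) auto
    then show False using that by (simp add: prod_encode_def)
  qed
qed

lemma computable_prod_decode:
  "computable (\<lambda>m. fst (prod_decode m))" "computable (\<lambda>m. snd (prod_decode m))"
proof -
  \<comment> \<open>The diagonal containing \<open>m\<close>. Once it is known, both coordinates
    follow by subtraction.\<close>
  define d where "d = (\<lambda>m. LEAST n. Suc m - triangle (Suc n) = 0)"
  have d: "d m = fst (prod_decode m) + snd (prod_decode m)" for m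
    using prod_decode_diagonal[of "fst (prod_decode m)" "snd (prod_decode m)"]
    by (simp add: d_def)
  have m: "m = triangle (d m) + fst (prod_decode m)" for m
    using prod_decode_inverse[of m] unfolding d prod_encode_def by (simp add: case_prod_beta)
  have "computable2 (\<lambda>n m. Suc m - triangle (Suc n))"
    by (rule computable2_app_swap[OF computable2_diff computable_Suc
          computable_comp[OF computable_triangle computable_Suc]])
  moreover have "\<exists>n. Suc m - triangle (Suc n) = 0" for m
    by (rule exI[of _ m]) simp
  ultimately have cd: "computable d" unfolding d_def by (rule computable_Least)
  have "fst (prod_decode m) = m - triangle (d m)" for m using m[of m] by linarith
  then show fst: "computable (\<lambda>m. fst (prod_decode m))"
    using computable_diff[OF computable_id computable_comp[OF computable_triangle cd]] by simp
  have "snd (prod_decode m) = d m - fst (prod_decode m)" for m by (simp add: d)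
  then show "computable (\<lambda>m. snd (prod_decode m))"
    using computable_diff[OF cd fst] by simp
qed

lemmas computable_fst = computable_comp[OF computable_prod_decode(1)]
lemmas computable_snd = computable_comp[OF computable_prod_decode(2)]


section \<open>Enumerable sets\<close>

lemma ce_set_range: "computable f \<Longrightarrow> ce_set (range f)"
  unfolding ce_set_def by blast

lemma ce_set_image:
  assumes "ce_set A" "computable f"
  shows "ce_set (f ` A)"
  using assms unfolding ce_set_def by (auto simp: image_image intro!: computable_comp)

lemma ce_set_Un:
  assumes "ce_set A" "ce_set B"
  shows "ce_set (A \<union> B)"
proof (cases "A = {} \<or> B = {}")
  case True
  then show ?thesis using assms by auto
next
  case False
  then obtain f g where f: "computable f" "A = range f" and g: "computable g" "B = range g"
    using assms unfolding ce_set_def by blast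
  \<comment> \<open>The first coordinate of \<open>n\<close> selects the enumeration (zero for
    \<open>f\<close>, anything else for \<open>g\<close>), the second is the index in it.\<close>
  define h where
    "h = (\<lambda>n. if fst (prod_decode n) = 0 then f (snd (prod_decode n)) else g (snd (prod_decode n)))"
  have "computable h" unfolding h_def
    by (intro computable_if computable_prod_decode f(1)[THEN computable_comp]
        g(1)[THEN computable_comp])
  moreover have "A \<union> B = range h"
  proof
    have "f k = h (prod_encode (0, k))" "g k = h (prod_encode (1, k))" for k
      by (simp_all add: h_def)
    then show "A \<union> B \<subseteq> range h" unfolding f g by (metis Un_least image_subsetI rangeI)
    show "range h \<subseteq> A \<union> B" by (auto simp: h_def f g)
  qed
  ultimately show ?thesis unfolding ce_set_def by blast
qed

lemma ce_set_Times:
  assumes "ce_set A" "ce_set B"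
  shows "ce_set (prod_encode ` (A \<times> B))"
proof (cases "A = {} \<or> B = {}")
  case True
  then show ?thesis by (auto simp: ce_set_def)
next
  case False
  then obtain f g where f: "computable f" "A = range f" and g: "computable g" "B = range g"
    using assms unfolding ce_set_def by blast
  define h where "h = (\<lambda>n. prod_encode (f (fst (prod_decode n)), g (snd (prod_decode n))))"
  have "computable h" unfolding h_def
    by (intro computable_prod_encode computable_prod_decode f(1)[THEN computable_comp]
        g(1)[THEN computable_comp])
  moreover have "prod_encode ` (A \<times> B) = range h"
  proof
    have "prod_encode (f i, g j) = h (prod_encode (i, j))" for i j by (simp add: h_def)
    then show "prod_encode ` (A \<times> B) \<subseteq> range h" unfolding f g by auto
    show "range h \<subseteq> prod_encode ` (A \<times> B)" by (auto simp: h_def f g)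
  qed
  ultimately show ?thesis unfolding ce_set_def by blast
qed

section \<open>Ceers: equivalence laws, enumeration and inversion of reductions\<close>

lemma ceer_equiv_UNIV: "ceer X \<Longrightarrow> equiv UNIV X"
  by (simp add: ceer_def)

lemma ceer_refl: "ceer X \<Longrightarrow> (x, x) \<in> X"
  using ceer_equiv_UNIV equiv_class_self by fastforce

lemma ceer_sym: "ceer X \<Longrightarrow> (x, y) \<in> X \<Longrightarrow> (y, x) \<in> X"
  by (meson ceer_equiv_UNIV equivE symE)

lemma ceer_trans: "ceer X \<Longrightarrow> (x, y) \<in> X \<Longrightarrow> (y, z) \<in> X \<Longrightarrow> (x, z) \<in> X"
  by (meson ceer_equiv_UNIV equivE transE)

text \<open>Reflexivity makes a ceer nonempty, which rules out the empty case of
  \<open>ce_set\<close>.\<close>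

lemma ceer_enumeration:
  assumes "ceer X"
  obtains e where "computable e" "prod_encode ` X = range e"
proof -
  have "prod_encode ` X \<noteq> {}" using ceer_refl[OF assms] by blast
  then show ?thesis using assms that unfolding ceer_def ce_set_def by blast
qed

lemma ce_set_class:
  assumes "ceer X"
  shows "ce_set (X `` {a})"
proof -
  \<comment> \<open>Pairs that do not start with \<open>a\<close> are sent to the default
    \<open>a\<close>, which lies in its own class.\<close>
  define f where "f = (\<lambda>m. if fst (prod_decode m) = a then snd (prod_decode m) else a)"
  have "computable f" unfolding f_def
    by (intro computable_if_eq computable_prod_decode computable_const)
  moreover have "X `` {a} = f ` prod_encode ` X"
  proof
    show "X `` {a} \<subseteq> f ` prod_encode ` X" by (force simp: f_def image_image)
    show "f ` prod_encode ` X \<subseteq> X `` {a}" by (auto simp: f_def ceer_refl[OF assms])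
  qed
  ultimately show ?thesis using assms ce_set_image unfolding ceer_def by metis
qed

text \<open>A reduction that meets every class can be inverted by searching the enumeration of
  \<open>X\<close> for a preimage up to equivalence. It is applied contrapositively: if
  \<open>X\<close> does not reduce to \<open>E\<close>, then \<open>f\<close> misses a
  class.\<close>

lemma reducible_of_surj:
  assumes X: "ceer X" and f: "computable f" "\<And>x y. (x, y) \<in> E \<longleftrightarrow> (f x, f y) \<in> X"
    and surj: "\<And>x. \<exists>y. (f y, x) \<in> X"
  shows "X \<preceq> E"
proof -
  obtain e where e: "computable e" "prod_encode ` X = range e"
    using ceer_enumeration[OF X] .
  \<comment> \<open>The argument codes \<open>(n, x)\<close>, and \<open>n\<close> codes
    \<open>(k, y)\<close>. Value 0 means that the \<open>k\<close>-th enumerated pair is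
    \<open>(f y, x)\<close>, so \<open>k\<close> certifies that \<open>f y\<close> is equivalent to
    \<open>x\<close>.\<close>
  define t where "t = (\<lambda>m. if e (fst (prod_decode (fst (prod_decode m)))) =
    prod_encode (f (snd (prod_decode (fst (prod_decode m)))), snd (prod_decode m))
    then 0 else 1 :: nat)"
  define s where "s = (\<lambda>x. LEAST n. t (prod_encode (n, x)) = 0)"
  define h where "h = (\<lambda>x. snd (prod_decode (s x)))"
  have t: "t (prod_encode (n, x)) = 0 \<longleftrightarrow>
      e (fst (prod_decode n)) = prod_encode (f (snd (prod_decode n)), x)" for n x
    by (simp add: t_def)
  have "computable t" unfolding t_def
    by (intro computable_if_eq computable_const computable_prod_encode computable_fst
        computable_snd computable_id e(1)[THEN computable_comp] f(1)[THEN computable_comp])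
  then have "computable2 (\<lambda>n x. t (prod_encode (n, x)))"
    using computable2_prod_encode by (rule computable_comp2)
  moreover have ex: "\<exists>n. t (prod_encode (n, x)) = 0" for x
  proof -
    obtain y where "(f y, x) \<in> X" using surj by blast
    then obtain k where "e k = prod_encode (f y, x)" using e(2) by (metis imageE imageI)
    then have "t (prod_encode (prod_encode (k, y), x)) = 0" by (simp add: t)
    then show ?thesis ..
  qed
  ultimately have "computable s" unfolding s_def by (rule computable_Least)
  then have "computable h" unfolding h_def by (rule computable_snd)
  moreover have h: "(f (h x), x) \<in> X" for x
  proof -
    have "t (prod_encode (s x, x)) = 0" unfolding s_def using ex by (rule LeastI_ex)
    then have "prod_encode (f (h x), x) \<in> prod_encode ` X"
      unfolding e(2) t h_def by (metis rangeI)
    then show ?thesis by (auto dest: inj_onD[OF inj_prod_encode])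
  qed
  have "(x, y) \<in> X \<longleftrightarrow> (h x, h y) \<in> E" for x y
    unfolding f(2) using h[of x] h[of y] ceer_sym[OF X] ceer_trans[OF X] by blast
  ultimately show ?thesis unfolding reducible_def by blast
qed


section \<open>The uniform join\<close>

text \<open>
  In place of even and odd numbers, \<open>E\<close> lives on the codes of pairs \<open>(0, x)\<close> and \<open>R\<close> on those of
  \<open>(i, x)\<close> with \<open>i \<noteq> 0\<close>, where the value of \<open>i\<close> is ignored.
\<close>

definition uniform_join :: "nat rel \<Rightarrow> nat rel \<Rightarrow> nat rel" where
  "uniform_join E R = {(u, v).
     fst (prod_decode u) = 0 \<and> fst (prod_decode v) = 0
       \<and> (snd (prod_decode u), snd (prod_decode v)) \<in> E
     \<or> fst (prod_decode u) \<noteq> 0 \<and> fst (prod_decode v) \<noteq> 0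
       \<and> (snd (prod_decode u), snd (prod_decode v)) \<in> R}"

lemma ceer_uniform_join:
  assumes "ceer E" "ceer R"
  shows "ceer (uniform_join E R)"
proof -
  let ?J = "uniform_join E R"
  have equiv: "equiv UNIV ?J"
    by (rule equivI)
      (auto simp: uniform_join_def refl_on_def sym_def trans_def ceer_refl[OF assms(1)]
        ceer_refl[OF assms(2)] intro: ceer_sym[OF assms(1)] ceer_sym[OF assms(2)]
          ceer_trans[OF assms(1)] ceer_trans[OF assms(2)])
  \<comment> \<open>\<open>f\<close> copies pairs of \<open>E\<close> to tag 0. Below,
    \<open>g\<close> combines a pair of \<open>R\<close> with a pair of tags; \<open>Suc\<close>
    makes both tags nonzero, and the factor \<open>UNIV\<close> supplies all choices of
    tags.\<close>
  define f where "f = (\<lambda>m. prod_encode (prod_encode (0, fst (prod_decode m)),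
    prod_encode (0, snd (prod_decode m))))"
  define g where "g = (\<lambda>m. prod_encode
    (prod_encode (Suc (fst (prod_decode (snd (prod_decode m)))), fst (prod_decode (fst (prod_decode m)))),
     prod_encode (Suc (snd (prod_decode (snd (prod_decode m)))), snd (prod_decode (fst (prod_decode m))))))"
  have "computable f" unfolding f_def
    by (intro computable_prod_encode computable_const computable_prod_decode)
  moreover have "computable g" unfolding g_def
    by (intro computable_prod_encode computable_comp[OF computable_Suc] computable_fst
        computable_snd computable_id)
  moreover have "ce_set (UNIV :: nat set)" using ce_set_range[OF computable_id] by simp
  moreover have "prod_encode ` ?J =
      f ` prod_encode ` E \<union> g ` prod_encode ` (prod_encode ` R \<times> UNIV)"
  proof (rule antisym)
    show "f ` prod_encode ` E \<union> g ` prod_encode ` (prod_encode ` R \<times> UNIV) \<subseteq> prod_encode ` ?J"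
      by (auto simp: f_def g_def uniform_join_def)
    have "prod_encode (u, v) \<in> f ` prod_encode ` E \<union> g ` prod_encode ` (prod_encode ` R \<times> UNIV)"
      if uv: "(u, v) \<in> ?J" for u v
    proof -
      obtain i x j y where u: "u = prod_encode (i, x)" and v: "v = prod_encode (j, y)"
        by (metis prod_decode_inverse surj_pair)
      consider "i = 0" "j = 0" "(x, y) \<in> E" | i' j' where "i = Suc i'" "j = Suc j'" "(x, y) \<in> R"
        using uv by (cases i; cases j) (auto simp: u v uniform_join_def)
      then show ?thesis
      proof cases
        case 1
        then have "prod_encode (u, v) = f (prod_encode (x, y))" by (simp add: f_def u v)
        with 1 show ?thesis by blast
      next
        case 2
        then have "prod_encode (u, v) =
            g (prod_encode (prod_encode (x, y), prod_encode (i', j')))"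
          by (simp add: g_def u v)
        with 2 show ?thesis by blast
      qed
    qed
    then show "prod_encode ` ?J \<subseteq> f ` prod_encode ` E \<union> g ` prod_encode ` (prod_encode ` R \<times> UNIV)"
      by auto
  qed
  ultimately have "ce_set (prod_encode ` ?J)"
    using assms by (auto simp: ceer_def intro!: ce_set_Un ce_set_image ce_set_Times)
  with equiv show ?thesis by (simp add: ceer_def)
qed

lemma reducible_uniform_join: "E \<preceq> uniform_join E R" "R \<preceq> uniform_join E R"
proof -
  have "computable (\<lambda>x. prod_encode (i, x))" for i
    by (intro computable_prod_encode computable_const computable_id)
  moreover have "(x, y) \<in> E \<longleftrightarrow> (prod_encode (0, x), prod_encode (0, y)) \<in> uniform_join E R"
    "(x, y) \<in> R \<longleftrightarrow> (prod_encode (1, x), prod_encode (1, y)) \<in> uniform_join E R" for x y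
    by (auto simp: uniform_join_def)
  ultimately show "E \<preceq> uniform_join E R" "R \<preceq> uniform_join E R"
    unfolding reducible_def by blast+
qed

text \<open>A computable sequence of pairwise inequivalent elements either stays on the
  \<open>R\<close> side from some point on, or visits the \<open>E\<close> side infinitely often.
  The tail or a computable subsequence then reduces \<open>Id\<close> to one side.\<close>

lemma Id_reducible_uniform_join:
  assumes "Id \<preceq> uniform_join E R"
  shows "Id \<preceq> E \<or> Id \<preceq> R"
proof -
  obtain h where h: "computable h" "\<And>x y. x = y \<longleftrightarrow> (h x, h y) \<in> uniform_join E R"
    using assms unfolding reducible_def by auto
  define tag val where "tag = (\<lambda>n. fst (prod_decode (h n)))" and "val = (\<lambda>n. snd (prod_decode (h n)))"
  have ctag: "computable tag" and cval: "computable val"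
    unfolding tag_def val_def using h(1) by (auto intro: computable_fst computable_snd)
  show ?thesis
  proof (cases "\<exists>k. \<forall>n. tag (k + n) \<noteq> 0")
    case True
    \<comment> \<open>Only a fixed \<open>k\<close> is needed, not a way to compute it: the tail
      starting at \<open>k\<close> is a computable sequence.\<close>
    then obtain k where k: "\<And>n. tag (k + n) \<noteq> 0" by blast
    have "x = y \<longleftrightarrow> (val (k + x), val (k + y)) \<in> R" for x y
      using h(2)[of "k + x" "k + y"] k[of x] k[of y] by (simp add: uniform_join_def tag_def val_def)
    moreover have "computable (\<lambda>x. val (k + x))"
      by (intro computable_comp[OF cval] computable_add computable_const computable_id)
    ultimately have "Id \<preceq> R" unfolding reducible_def by (intro exI[of _ "\<lambda>x. val (k + x)"]) simp
    then show ?thesis ..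
  next
    case False
    then have ex: "\<exists>i. tag (k + i) = 0" for k by auto
    \<comment> \<open>The search for the next index with tag 0 always halts, since such indices are
      unbounded.\<close>
    define gap where "gap = (\<lambda>m. LEAST i. tag (Suc m + i) = 0)"
    define next0 where "next0 = (\<lambda>m. Suc m + gap m)"
    have tag: "tag (next0 m) = 0" for m
      unfolding next0_def gap_def using ex by (rule LeastI_ex)
    have "computable2 (\<lambda>i m. Suc m + i)"
      by (rule computable2_app_swap[OF computable2_add computable_Suc computable_id])
    then have "computable2 (\<lambda>i m. tag (Suc m + i))" by (rule computable_comp2[OF ctag])
    then have "computable gap" unfolding gap_def
      using ex by (rule computable_Least)
    then have "computable next0" unfolding next0_def by (intro computable_add computable_Suc)
    \<comment> \<open>The outer \<open>next0\<close> ensures tag 0 already at \<open>n = 0\<close>.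
      Index 0 is skipped, which is harmless: only strict monotonicity and tag 0 matter.\<close>
    define s where "s = (\<lambda>n. next0 ((next0 ^^ n) 0))"
    have s_computable: "computable s" unfolding s_def
      by (intro computable_comp[OF \<open>computable next0\<close>] computable_funpow \<open>computable next0\<close>)
    have "strict_mono s" by (simp add: strict_mono_Suc_iff s_def next0_def)
    then have "x = y \<longleftrightarrow> (val (s x), val (s y)) \<in> E" for x y
      using h(2)[of "s x" "s y"] tag strict_mono_eq[of s x y]
      by (simp add: uniform_join_def tag_def val_def s_def)
    moreover have "computable (\<lambda>x. val (s x))" by (rule computable_comp[OF cval s_computable])
    ultimately have "Id \<preceq> E" unfolding reducible_def by (intro exI[of _ "\<lambda>x. val (s x)"]) simp
    then show ?thesis ..
  qed
qed


section \<open>Merging two classes\<close>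

text \<open>The equivalence relation generated by a ceer \<open>X\<close> and the pair
  \<open>(a, b)\<close>. The closed form makes enumerability a matter of unions and
  products.\<close>

definition merge :: "nat rel \<Rightarrow> nat \<Rightarrow> nat \<Rightarrow> nat rel" where
  "merge X a b = X \<union> (X `` {a} \<union> X `` {b}) \<times> (X `` {a} \<union> X `` {b})"

lemma ceer_merge:
  assumes "ceer X"
  shows "ceer (merge X a b)"
proof -
  note X = ceer_refl[OF assms] ceer_sym[OF assms] ceer_trans[OF assms]
  have "refl (merge X a b)" using X(1) by (auto simp: merge_def refl_on_def)
  moreover have "sym (merge X a b)" using X(2) by (auto simp: merge_def sym_def)
  moreover have "trans (merge X a b)" unfolding merge_def trans_def using X(2,3) by blast
  ultimately have "equiv UNIV (merge X a b)" by (auto intro: equivI)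
  moreover have "ce_set (prod_encode ` merge X a b)"
    using assms unfolding merge_def image_Un
    by (intro ce_set_Un ce_set_Times ce_set_class) (auto simp: ceer_def)
  ultimately show ?thesis by (simp add: ceer_def)
qed

text \<open>Every new pair of the quotient joins the class of \<open>a\<close> to that of
  \<open>b\<close>. If the range of \<open>f\<close> avoids one of these classes, no two values of
  \<open>f\<close> become newly equivalent.\<close>

lemma reducible_merge:
  assumes X: "ceer X" and f: "computable f" "\<And>x y. (x, y) \<in> E \<longleftrightarrow> (f x, f y) \<in> X"
    and missed: "(\<forall>x. (f x, a) \<notin> X) \<or> (\<forall>x. (f x, b) \<notin> X)"
  shows "E \<preceq> merge X a b"
proof -
  have "(f x, f y) \<in> merge X a b \<longleftrightarrow> (f x, f y) \<in> X" for x y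
    using missed ceer_sym[OF X] ceer_trans[OF X] unfolding merge_def by blast
  then show ?thesis using f unfolding reducible_def by blast
qed

section \<open>Orbits of a reduction to a merged ceer\<close>

lemma funpow_reflects:
  assumes "\<And>u v. (f u, f v) \<in> X \<Longrightarrow> (u, v) \<in> X"
  shows "((f ^^ k) u, (f ^^ k) v) \<in> X \<Longrightarrow> (u, v) \<in> X"
  by (induction k) (auto dest: assms)

text \<open>If the iterates of \<open>x\<close> were pairwise inequivalent, they would reduce
  \<open>Id\<close> to \<open>X\<close>. So two iterates are equivalent, and cancelling the common
  applications of \<open>f\<close> leaves a return to \<open>x\<close> itself.\<close>

lemma orbit_returns:
  assumes "\<not> Id \<preceq> X" and X: "ceer X" and f: "computable f"
    and reflects: "\<And>u v. (f u, f v) \<in> X \<Longrightarrow> (u, v) \<in> X"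
  shows "\<exists>n>0. (x, (f ^^ n) x) \<in> X"
proof -
  note shift = funpow_reflects[of f X, OF reflects]
  have "\<not> (\<forall>i j. i = j \<longleftrightarrow> ((f ^^ i) x, (f ^^ j) x) \<in> X)"
    using assms(1) computable_funpow[OF f, of x] unfolding reducible_def by auto
  then obtain i j where "i \<noteq> j" "((f ^^ i) x, (f ^^ j) x) \<in> X"
    using ceer_refl[OF X] by blast
  then obtain i j where "i < j" and ij: "((f ^^ i) x, (f ^^ j) x) \<in> X"
    using ceer_sym[OF X] by (metis linorder_neqE_nat)
  have "(f ^^ j) x = (f ^^ i) ((f ^^ (j - i)) x)"
    using \<open>i < j\<close> funpow_add[of i "j - i" f] by simp
  with ij have "(x, (f ^^ (j - i)) x) \<in> X" using shift by simp
  with \<open>i < j\<close> show ?thesis by (intro exI[of _ "j - i"]) simp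
qed

lemma not_reducible_merge:
  assumes "\<not> Id \<preceq> X" and X: "ceer X" and ab: "(a, b) \<notin> X"
  shows "\<not> X \<preceq> merge X a b"
proof
  assume "X \<preceq> merge X a b"
  then obtain f where f: "computable f" "\<And>x y. (x, y) \<in> X \<longleftrightarrow> (f x, f y) \<in> merge X a b"
    unfolding reducible_def by blast
  have reflects: "(f u, f v) \<in> X \<Longrightarrow> (u, v) \<in> X" for u v
    unfolding f(2)[of u] by (simp add: merge_def)
  note returns = orbit_returns[OF assms(1) X f(1) reflects]
  note sym = ceer_sym[OF X] and trans = ceer_trans[OF X]
  note shift = funpow_reflects[of f X, OF reflects]
  \<comment> \<open>Values in the classes of \<open>a\<close> and \<open>b\<close> are equivalent in
    the quotient, so all their preimages form at most one class of \<open>X\<close>.\<close>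
  have merged: "(u, v) \<in> X" if "(c, f u) \<in> X" "(d, f v) \<in> X" "c \<in> {a, b}" "d \<in> {a, b}" for u v c d
    using that unfolding f(2)[of u] merge_def by blast
  text \<open>\<open>c\<close> and \<open>d\<close> are \<open>a\<close> and \<open>b\<close> in the order of their first return times.\<close>
  have False if "c \<in> {a, b}" "d \<in> {a, b}" "(c, d) \<notin> X" "0 < n" "(c, (f ^^ n) c) \<in> X"
    "n \<le> m" "(d, (f ^^ m) d) \<in> X" and minimal: "\<And>k. 0 < k \<Longrightarrow> k < m \<Longrightarrow> (d, (f ^^ k) d) \<notin> X"
    for c d n m
  proof -
    obtain n' where n': "n = Suc n'" using \<open>0 < n\<close> by (cases n) auto
    obtain m' where m': "m = Suc m'" using \<open>0 < n\<close> \<open>n \<le> m\<close> by (cases m) auto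
    have fd: "(d, f ((f ^^ m') d)) \<in> X" using \<open>(d, (f ^^ m) d) \<in> X\<close> by (simp add: m')
    \<comment> \<open>The last points before the returns of \<open>c\<close> and \<open>d\<close>
      are both preimages of merged classes, hence equivalent.\<close>
    have pre: "((f ^^ n') c, (f ^^ m') d) \<in> X"
      using \<open>(c, (f ^^ n) c) \<in> X\<close> \<open>c \<in> {a, b}\<close> \<open>d \<in> {a, b}\<close>
      by (intro merged[OF _ fd]) (simp_all only: n' funpow.simps o_apply)
    have "m' = n' + (m - n)" using \<open>n \<le> m\<close> n' m' by linarith
    then have "(f ^^ m') d = (f ^^ n') ((f ^^ (m - n)) d)" by (simp only: funpow_add o_apply)
    \<comment> \<open>Cancelling \<open>n'\<close> applications of \<open>f\<close> puts
      \<open>c\<close> on the orbit of \<open>d\<close> at time \<open>m - n\<close>. For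
      \<open>n = m\<close> this would make \<open>c\<close> and \<open>d\<close> equivalent.\<close>
    with pre have c: "(c, (f ^^ (m - n)) d) \<in> X" using shift by simp
    with \<open>(c, d) \<notin> X\<close> have "n < m" using \<open>n \<le> m\<close> by (cases "n = m") auto
    then obtain k where k: "m - n = Suc k" by (metis Suc_diff_Suc)
    \<comment> \<open>Now the orbit of \<open>d\<close> itself reaches \<open>c\<close> at time
      \<open>Suc k\<close> and \<open>d\<close> at time \<open>m\<close>, so the points just before
      are equivalent. Cancelling \<open>k\<close> applications gives a return of \<open>d\<close> at
      time \<open>n < m\<close>.\<close>
    have "((f ^^ k) d, (f ^^ m') d) \<in> X"
      using c \<open>c \<in> {a, b}\<close> \<open>d \<in> {a, b}\<close>
      by (intro merged[OF _ fd]) (simp_all only: k funpow.simps o_apply)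
    moreover have "(f ^^ m') d = (f ^^ k) ((f ^^ n) d)"
    proof -
      have "m' = k + n" using k m' \<open>n < m\<close> by linarith
      then show ?thesis by (simp only: funpow_add o_apply)
    qed
    ultimately have "(d, (f ^^ n) d) \<in> X" using shift by simp
    with minimal \<open>0 < n\<close> \<open>n < m\<close> show False by blast
  qed
  note contradiction = this
  \<comment> \<open>The least positive return time, which exists by \<open>returns\<close>.
    Comparing \<open>time a\<close> and \<open>time b\<close> decides which of the two points plays
    \<open>c\<close>.\<close>
  define time where "time = (\<lambda>x. LEAST n. 0 < n \<and> (x, (f ^^ n) x) \<in> X)"
  have time: "0 < time x \<and> (x, (f ^^ time x) x) \<in> X" for x
    unfolding time_def using returns by (rule LeastI_ex)
  have least: "(x, (f ^^ k) x) \<notin> X" if "0 < k" "k < time x" for x k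
    using that not_less_Least unfolding time_def by blast
  show False
  proof (cases "time a \<le> time b")
    case True
    then show False using contradiction[of a b "time a" "time b"] time ab least by auto
  next
    case False
    then show False using contradiction[of b a "time b" "time a"] time ab sym least by auto
  qed
qed

section \<open>Upper bounds and least upper bounds\<close>

lemma exists_upper_bound_not_above:
  assumes "\<not> Id \<preceq> X" "ceer X" "E1 \<preceq> X" "E2 \<preceq> X" "\<not> X \<preceq> E1" "\<not> X \<preceq> E2"
  shows "\<exists>Y. ceer Y \<and> E1 \<preceq> Y \<and> E2 \<preceq> Y \<and> \<not> X \<preceq> Y"
proof -
  note X = \<open>ceer X\<close>
  obtain f g where f: "computable f" "\<And>x y. (x, y) \<in> E1 \<longleftrightarrow> (f x, f y) \<in> X"
    and g: "computable g" "\<And>x y. (x, y) \<in> E2 \<longleftrightarrow> (g x, g y) \<in> X"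
    using assms(3,4) unfolding reducible_def by blast
  \<comment> \<open>If \<open>f\<close> or \<open>g\<close> met every class, it could be inverted,
    and \<open>X\<close> would reduce to \<open>E1\<close> or \<open>E2\<close>.\<close>
  obtain a b where a: "\<And>x. (f x, a) \<notin> X" and b: "\<And>x. (g x, b) \<notin> X"
    using reducible_of_surj[OF X f] reducible_of_surj[OF X g] assms(5,6) by blast
  \<comment> \<open>Normally \<open>c\<close> is \<open>b\<close>. If \<open>a\<close> and
    \<open>b\<close> share a class, that class is missed by both reductions, and \<open>a\<close>
    may be merged with any other class; \<open>f 0\<close> provides one because \<open>f\<close>
    misses \<open>a\<close>.\<close>
  obtain c where c: "(a, c) \<notin> X" "(\<forall>x. (g x, a) \<notin> X) \<or> (\<forall>x. (g x, c) \<notin> X)"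
  proof (cases "(a, b) \<in> X")
    case True
    then have "(g x, a) \<notin> X" for x using b ceer_trans[OF X] by blast
    moreover have "(a, f 0) \<notin> X" using a ceer_sym[OF X] by blast
    ultimately show ?thesis using that by blast
  next
    case False
    then show ?thesis using that b by blast
  qed
  have "E1 \<preceq> merge X a c" "E2 \<preceq> merge X a c"
    using a c(2) by (auto intro!: reducible_merge[OF X f] reducible_merge[OF X g])
  then show ?thesis
    using ceer_merge[OF X] not_reducible_merge[OF assms(1) X c(1)] by blast
qed

text \<open>The order on degrees does not depend on representatives, so the least upper bound
  property can be tested on ceers.\<close>

lemma degree_is_lub_iff:
  assumes "ceer X" "ceer E" "ceer R"
  shows "is_lub ceer_degrees (degree X) {degree E, degree R} \<longleftrightarrow>
    E \<preceq> X \<and> R \<preceq> X \<and> (\<forall>Y. ceer Y \<and> E \<preceq> Y \<and> R \<preceq> Y \<longrightarrow> X \<preceq> Y)"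
proof -
  have "Upper ceer_degrees {degree E, degree R} = degree ` {Y. ceer Y \<and> E \<preceq> Y \<and> R \<preceq> Y}"
    using assms(2,3) degree_in_carrier
    by (fastforce simp: Upper_def carrier_ceer_degrees degree_le_iff)
  \<comment> \<open>A ceer \<open>Y\<close> of the same degree may witness membership; its bounds
    pass to \<open>X\<close> by transitivity.\<close>
  moreover have "degree X \<in> degree ` {Y. ceer Y \<and> E \<preceq> Y \<and> R \<preceq> Y} \<longleftrightarrow> E \<preceq> X \<and> R \<preceq> X"
  proof
    assume "degree X \<in> degree ` {Y. ceer Y \<and> E \<preceq> Y \<and> R \<preceq> Y}"
    then obtain Y where "ceer Y" "E \<preceq> Y" "R \<preceq> Y" "degree X = degree Y" by blast
    then show "E \<preceq> X \<and> R \<preceq> X" using degree_eq_iff[OF assms(1)] reducible_trans by blast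
  qed (use assms(1) in blast)
  moreover have "degree ` {Y. ceer Y \<and> E \<preceq> Y \<and> R \<preceq> Y} \<subseteq> carrier ceer_degrees"
    using degree_in_carrier by blast
  ultimately show ?thesis
    using assms(1) by (simp add: least_def degree_le_iff)
qed

theorem theorem5p8:
  fixes E1 E2 :: "nat rel"
  assumes "dark E1" and "dark E2"
    and "\<not> E1 \<preceq> E2" and "\<not> E2 \<preceq> E1"
  shows "\<not> (\<exists>d. is_lub ceer_degrees d {degree E1, degree E2})"
proof
  have E: "ceer E1" "ceer E2" and Id: "\<not> Id \<preceq> E1" "\<not> Id \<preceq> E2"
    using assms(1,2) by (auto simp: dark_def)
  assume "\<exists>d. is_lub ceer_degrees d {degree E1, degree E2}"
  then obtain d where d: "is_lub ceer_degrees d {degree E1, degree E2}" ..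
  then have "d \<in> carrier ceer_degrees" by (simp add: least_def Upper_def)
  then obtain X where X: "ceer X" "d = degree X" by (auto simp: carrier_ceer_degrees)
  have ub: "E1 \<preceq> X" "E2 \<preceq> X" and least: "\<And>Y. ceer Y \<Longrightarrow> E1 \<preceq> Y \<Longrightarrow> E2 \<preceq> Y \<Longrightarrow> X \<preceq> Y"
    using d degree_is_lub_iff[OF X(1) E] X(2) by blast+
  \<comment> \<open>The join is one upper bound, so \<open>X\<close> lies below it; this transfers
    the failure of \<open>Id\<close> to reduce from \<open>E1\<close> and \<open>E2\<close> to
    \<open>X\<close>.\<close>
  have "X \<preceq> uniform_join E1 E2"
    using least ceer_uniform_join[OF E] reducible_uniform_join by blast
  then have "\<not> Id \<preceq> X" using Id Id_reducible_uniform_join reducible_trans by blast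
  \<comment> \<open>A reduction of \<open>X\<close> to one of the two ceers would reduce the other
    to it, against incomparability.\<close>
  moreover have "\<not> X \<preceq> E1" "\<not> X \<preceq> E2" using ub assms(3,4) reducible_trans by blast+
  ultimately show False
    using exists_upper_bound_not_above[OF _ X(1) ub] least by blast
qed

end
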